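(* Let $T$ be a tournament with $|V(T)|\le 3$ and let $ET$ be any extended tournament of $T$. Then $\chi'_{\mathrm{wo}}(ET)\le 2$.
   Context: A tournament is an orientation of a complete graph. Given a tournament $T$ with vertices $v_1,\dots,v_n$ and integers $s_1,\dots,s_n\ge 1$, the extended tournament $ET$ has vertex set $I_1\cup\dots\cup I_n$ (disjoint sets, $|I_i|=s_i$, each $I_i$ independent), and for $x\in I_i$, $y\in I_j$ ($i\ne j$) there is an arc $xy$ iff $v_iv_j\in A(T)$. For a vertex $v$ of a digraph $D$, the semi-cuts of $v$ are $\partial^+(v)$ (arcs leaving $v$) and $\partial^-(v)$ (arcs entering $v$). A map $\varphi:A(D)\to[k]=\{1,\dots,k\}$ satisfies condition (WO) at $v$ if there is a color $i\in[k]$ such that every nonempty semi-cut of $v$ contains an odd number of arcs of color $i$ (vacuous if both semi-cuts are empty). A weak-odd $k$-edge coloring is such a map satisfying (WO) at every vertex, and the weak-odd chromatic index $\chi'_{\mathrm{wo}}(D)$ is the least $k\ge0$ for which one exists. *)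

theory Defs
  imports
    "Graph_Theory.Pair_Digraph"
    "HOL-Library.Extended_Nat"
    "HOL-Library.Disjoint_Sets"
begin

locale tournament = pair_digraph T for T :: "'a pair_pre_digraph" +
  assumes one_direction:
    "\<And>u v. u \<in> pverts T \<Longrightarrow> v \<in> pverts T \<Longrightarrow> u \<noteq> v \<Longrightarrow>
      (u, v) \<in> parcs T \<longleftrightarrow> (v, u) \<notin> parcs T"

text \<open>
  The vertices of \<^term>\<open>T\<close> index the classes \<^term>\<open>I v\<close> and their sizes
  \<^term>\<open>s v\<close>. Independence of the classes is not listed separately: \<^term>\<open>T\<close> has no
  loops and the classes are disjoint, so no arc of \<^term>\<open>E\<close> joins two vertices of one class.
\<close>

definition extended_tournament ::
  "'a pair_pre_digraph \<Rightarrow> ('a \<Rightarrow> nat) \<Rightarrow> 'b pair_pre_digraph \<Rightarrow> bool" where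
  "extended_tournament T s E \<longleftrightarrow>
    tournament T \<and> (\<forall>v\<in>pverts T. s v \<ge> 1) \<and>
    (\<exists>I :: 'a \<Rightarrow> 'b set.
      (\<forall>v\<in>pverts T. finite (I v) \<and> card (I v) = s v) \<and>
      disjoint_family_on I (pverts T) \<and>
      pverts E = (\<Union>v\<in>pverts T. I v) \<and>
      parcs E = (\<Union>(u, v)\<in>parcs T. I u \<times> I v))"

definition semi_cuts :: "('a, 'b) pre_digraph \<Rightarrow> 'a \<Rightarrow> 'b set set" where
  "semi_cuts D v = {out_arcs D v, in_arcs D v}"

text \<open>
  The first disjunct makes the condition hold at isolated vertices even for
  \<^term>\<open>k = 0\<close>, when there is no color to choose.
\<close>

definition weak_odd_at :: "('a, 'b) pre_digraph \<Rightarrow> nat \<Rightarrow> ('b \<Rightarrow> nat) \<Rightarrow> 'a \<Rightarrow> bool" where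
  "weak_odd_at D k \<phi> v \<longleftrightarrow>
    (\<forall>C\<in>semi_cuts D v. C = {}) \<or>
    (\<exists>i\<in>{1..k}. \<forall>C\<in>semi_cuts D v. C \<noteq> {} \<longrightarrow> odd (card {e \<in> C. \<phi> e = i}))"

definition weak_odd_edge_coloring :: "('a, 'b) pre_digraph \<Rightarrow> nat \<Rightarrow> ('b \<Rightarrow> nat) \<Rightarrow> bool" where
  "weak_odd_edge_coloring D k \<phi> \<longleftrightarrow>
    \<phi> \<in> arcs D \<rightarrow> {1..k} \<and> (\<forall>v\<in>verts D. weak_odd_at D k \<phi> v)"

text \<open>
  The value is \<^term>\<open>\<infinity> :: enat\<close> if no weak-odd coloring exists, so a finite upper bound
  entails existence.
\<close>

definition weak_odd_chromatic_index :: "('a, 'b) pre_digraph \<Rightarrow> enat" where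
  "weak_odd_chromatic_index D = Inf (enat ` {k. \<exists>\<phi>. weak_odd_edge_coloring D k \<phi>})"

end

theory Submission
  imports Defs
begin

text \<open>
  Call a vertex set \<open>S\<close> odd if every nonempty out- or in-neighbourhood meets \<open>S\<close> in an odd
  number of vertices. Given such an \<open>S\<close>, color an arc 1 if exactly one of its ends lies in \<open>S\<close>,
  and 2 otherwise: color 1 is then odd at the vertices outside \<open>S\<close>, and color 2 at those in \<open>S\<close>.
  Picking one representative from each class lifts an odd set of \<open>T\<close> to one of the
  extended tournament. In a tournament a source and a sink together form an odd set. If one of them
  is missing and there are at most three vertices, then every nonempty neighbourhood is a
  single vertex, so the set of all vertices is odd.
\<close>

definition odd_dominating :: "'a rel \<Rightarrow> 'a set \<Rightarrow> bool" where
  "odd_dominating R S \<longleftrightarrow> (\<forall>v\<in>Domain R. odd (card (R `` {v} \<inter> S)))"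

definition odd_set :: "'a rel \<Rightarrow> 'a set \<Rightarrow> bool" where
  "odd_set R S \<longleftrightarrow> odd_dominating R S \<and> odd_dominating (R\<inverse>) S"

lemma odd_set_converse: "odd_set (R\<inverse>) S \<longleftrightarrow> odd_set R S"
  by (auto simp: odd_set_def)

lemma odd_card_color_if_odd_dominating:
  assumes "odd_dominating R S" and "inj g" and color: "\<And>w. \<phi> (g w) = i \<longleftrightarrow> w \<in> S"
    and "g ` (R `` {v}) \<noteq> {}"
  shows "odd (card {e \<in> g ` (R `` {v}). \<phi> e = i})"
proof -
  have "{e \<in> g ` (R `` {v}). \<phi> e = i} = g ` (R `` {v} \<inter> S)"
    using color by auto
  moreover have "inj_on g (R `` {v} \<inter> S)" using \<open>inj g\<close> by (rule inj_on_subset) simp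
  moreover have "v \<in> Domain R" using assms(4) by auto
  ultimately show ?thesis using assms(1) by (simp add: odd_dominating_def card_image)
qed

lemma weak_odd_edge_coloring_odd_set:
  assumes "odd_set (parcs D) S"
  shows "weak_odd_edge_coloring (with_proj D) 2
    (\<lambda>(u, v). if (u \<in> S) \<noteq> (v \<in> S) then 1 else 2)"
    (is "weak_odd_edge_coloring _ _ ?\<phi>")
  unfolding weak_odd_edge_coloring_def
proof (intro conjI ballI)
  show "?\<phi> \<in> arcs (with_proj D) \<rightarrow> {1..2}" by auto
next
  fix v
  define i :: nat where "i = (if v \<in> S then 2 else 1)"
  have out_arcs: "out_arcs (with_proj D) v = Pair v ` (parcs D `` {v})"
    by (auto simp: out_arcs_def)
  have in_arcs: "in_arcs (with_proj D) v = (\<lambda>u. (u, v)) ` ((parcs D)\<inverse> `` {v})"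
    by (auto simp: in_arcs_def)
  have "odd (card {e \<in> out_arcs (with_proj D) v. ?\<phi> e = i})"
    if "out_arcs (with_proj D) v \<noteq> {}"
    unfolding out_arcs
  proof (rule odd_card_color_if_odd_dominating)
    show "odd_dominating (parcs D) S" using assms by (simp add: odd_set_def)
    show "Pair v ` (parcs D `` {v}) \<noteq> {}" using that unfolding out_arcs .
  qed (auto simp: i_def inj_def)
  moreover have "odd (card {e \<in> in_arcs (with_proj D) v. ?\<phi> e = i})"
    if "in_arcs (with_proj D) v \<noteq> {}"
    unfolding in_arcs
  proof (rule odd_card_color_if_odd_dominating)
    show "odd_dominating ((parcs D)\<inverse>) S" using assms by (simp add: odd_set_def)
    show "(\<lambda>u. (u, v)) ` ((parcs D)\<inverse> `` {v}) \<noteq> {}"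
      using that unfolding in_arcs .
  qed (auto simp: i_def inj_def)
  moreover have "i \<in> {1..2}" by (simp add: i_def)
  ultimately show "weak_odd_at (with_proj D) 2 ?\<phi> v"
    unfolding weak_odd_at_def semi_cuts_def by blast
qed

lemma weak_odd_chromatic_index_le:
  assumes "weak_odd_edge_coloring D k \<phi>"
  shows "weak_odd_chromatic_index D \<le> enat k"
  unfolding weak_odd_chromatic_index_def using assms by (auto intro: Inf_lower)

lemma weak_odd_chromatic_index_le_2_if_odd_set:
  assumes "odd_set (parcs D) S"
  shows "weak_odd_chromatic_index (with_proj D) \<le> 2"
  using weak_odd_chromatic_index_le[OF weak_odd_edge_coloring_odd_set[OF assms]]
  by (simp add: numeral_eq_enat)

lemma odd_dominating_inv_image:
  assumes "odd_dominating R U" and bij: "bij_betw f S U" and "S \<subseteq> X"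
  shows "odd_dominating (Restr (inv_image R f) X) S"
  unfolding odd_dominating_def
proof
  fix x assume x_Domain: "x \<in> Domain (Restr (inv_image R f) X)"
  then have "Restr (inv_image R f) X `` {x} \<inter> S = {y \<in> S. f y \<in> R `` {f x}}"
    using \<open>S \<subseteq> X\<close> by (auto simp: inv_image_def)
  moreover have "bij_betw f {y \<in> S. f y \<in> R `` {f x}} (R `` {f x} \<inter> U)"
    using bij unfolding bij_betw_def inj_on_def by auto
  moreover have "f x \<in> Domain R" using x_Domain by (auto simp: inv_image_def)
  ultimately show "odd (card (Restr (inv_image R f) X `` {x} \<inter> S))"
    using assms(1) by (simp add: odd_dominating_def bij_betw_same_card)
qed

lemma odd_set_inv_image:
  assumes "odd_set R U" and "U \<subseteq> f ` X"
  obtains S where "odd_set (Restr (inv_image R f) X) S"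
proof -
  obtain S where S: "S \<subseteq> X" "bij_betw f S U"
    using assms(2) by (auto simp: subset_image_inj bij_betw_def)
  have "(Restr (inv_image R f) X)\<inverse> = Restr (inv_image (R\<inverse>) f) X"
    by (auto simp: inv_image_def)
  then have "odd_set (Restr (inv_image R f) X) S"
    using assms(1) odd_dominating_inv_image[OF _ S(2,1)] by (simp add: odd_set_def)
  then show thesis by (rule that)
qed

lemma (in pair_wf_digraph) parcs_subset_pverts: "parcs G \<subseteq> pverts G \<times> pverts G"
  using in_arcsD1 in_arcsD2 by auto

lemma extended_tournament_projection:
  fixes E :: "'b pair_pre_digraph"
  assumes "extended_tournament T s E"
  obtains f where "f ` pverts E = pverts T"
    and "parcs E = Restr (inv_image (parcs T) f) (pverts E)"
proof -
  have tournament: "tournament T" and pos: "\<forall>v\<in>pverts T. s v \<ge> 1"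
    using assms unfolding extended_tournament_def by auto
  obtain I :: "'a \<Rightarrow> 'b set"
    where sizes: "\<forall>v\<in>pverts T. finite (I v) \<and> card (I v) = s v"
      and disjoint: "disjoint_family_on I (pverts T)"
      and verts: "pverts E = (\<Union>v\<in>pverts T. I v)"
      and arcs: "parcs E = (\<Union>(u, v)\<in>parcs T. I u \<times> I v)"
    using assms unfolding extended_tournament_def by blast
  interpret tournament T by (fact tournament)
  define f where "f x = (THE v. v \<in> pverts T \<and> x \<in> I v)" for x
  have f_eq: "f x = v" if "v \<in> pverts T" "x \<in> I v" for x v
    unfolding f_def using that disjoint
    by (intro the_equality) (auto simp: disjoint_family_on_def)
  have fiber: "I v = {x \<in> pverts E. f x = v}" if "v \<in> pverts T" for v
    using that by (auto simp: verts f_eq)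
  have "\<exists>x. x \<in> I v" if "v \<in> pverts T" for v
    using that sizes pos by (metis card.empty ex_in_conv not_one_le_zero)
  then have "pverts T \<subseteq> f ` pverts E" using fiber by auto
  moreover have "f ` pverts E \<subseteq> pverts T" by (auto simp: verts f_eq)
  ultimately have image: "f ` pverts E = pverts T" by simp
  have "parcs E = (\<Union>(u, v)\<in>parcs T. {x \<in> pverts E. f x = u} \<times> {y \<in> pverts E. f y = v})"
    unfolding arcs by (intro SUP_cong) (auto simp: fiber in_arcsD1 in_arcsD2)
  also have "\<dots> = Restr (inv_image (parcs T) f) (pverts E)" by auto
  finally have "parcs E = Restr (inv_image (parcs T) f) (pverts E)" .
  with image show thesis by (rule that)
qed

lemma odd_dominating_single_valued:
  assumes "single_valued R" and "Range R \<subseteq> S"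
  shows "odd_dominating R S"
  unfolding odd_dominating_def
proof
  fix v assume "v \<in> Domain R"
  then obtain w where "(v, w) \<in> R" by blast
  then have "R `` {v} \<inter> S = {w}" using assms by (auto dest: single_valuedD)
  then show "odd (card (R `` {v} \<inter> S))" by simp
qed

lemma odd_dominating_source_sink:
  assumes "total_on V R" and "Domain R \<subseteq> V"
    and "a \<notin> Range R" and "z \<in> V" "z \<notin> Domain R"
  shows "odd_dominating R {a, z}"
  unfolding odd_dominating_def
proof
  fix v assume "v \<in> Domain R"
  then have "v \<in> V" "v \<noteq> z" "(z, v) \<notin> R" using assms(2,5) by auto
  then have "(v, z) \<in> R" using assms(1,4) by (auto simp: total_on_def)
  then have "R `` {v} \<inter> {a, z} = {z}" using assms(3) by auto
  then show "odd (card (R `` {v} \<inter> {a, z}))" by simp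
qed

lemma odd_set_source_sink:
  assumes "total_on V R" and "R \<subseteq> V \<times> V"
    and "a \<in> V" "a \<notin> Range R" and "z \<in> V" "z \<notin> Domain R"
  shows "odd_set R {a, z}"
proof -
  have "odd_dominating R {a, z}"
    by (rule odd_dominating_source_sink[of V]) (use assms in auto)
  moreover have "odd_dominating (R\<inverse>) {z, a}"
    by (rule odd_dominating_source_sink[of V]) (use assms in auto)
  ultimately show ?thesis by (simp add: odd_set_def insert_commute)
qed

lemma single_valued_if_no_sink_card_le_3:
  assumes "finite V" and "card V \<le> 3" and "R \<subseteq> V \<times> V" and "asym R" and "V \<subseteq> Domain R"
  shows "single_valued R" and "single_valued (R\<inverse>)"
proof -
  have irrefl: "x \<noteq> y" if "(x, y) \<in> R" for x y
    using that \<open>asym R\<close> by (auto dest: asymD)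
  have V_eq: "V = {a, b, c}" if "{a, b, c} \<subseteq> V" "a \<noteq> b" "a \<noteq> c" "b \<noteq> c" for a b c
    using that card_seteq[of V "{a, b, c}"] \<open>finite V\<close> \<open>card V \<le> 3\<close> by simp
  show "single_valued R"
  proof (intro single_valuedI, rule ccontr)
    fix a b c assume arcs: "(a, b) \<in> R" "(a, c) \<in> R" and "b \<noteq> c"
    then have V: "V = {a, b, c}"
      using \<open>R \<subseteq> V \<times> V\<close> irrefl by (intro V_eq) auto
    have "(b, a) \<notin> R" "(c, a) \<notin> R" using arcs \<open>asym R\<close> by (auto dest: asymD)
    then have "(b, c) \<in> R" "(c, b) \<in> R"
      using V \<open>V \<subseteq> Domain R\<close> \<open>R \<subseteq> V \<times> V\<close> irrefl by blast+
    then show False using \<open>asym R\<close> by (auto dest: asymD)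
  qed
  show "single_valued (R\<inverse>)"
  proof (intro single_valuedI, rule ccontr)
    fix a b c assume "(a, b) \<in> R\<inverse>" "(a, c) \<in> R\<inverse>" and "b \<noteq> c"
    then have arcs: "(b, a) \<in> R" "(c, a) \<in> R" by auto
    then have V: "V = {a, b, c}"
      using \<open>b \<noteq> c\<close> \<open>R \<subseteq> V \<times> V\<close> irrefl by (intro V_eq) auto
    have "(a, b) \<notin> R" "(a, c) \<notin> R" using arcs \<open>asym R\<close> by (auto dest: asymD)
    then show False
      using V \<open>V \<subseteq> Domain R\<close> \<open>R \<subseteq> V \<times> V\<close> irrefl by blast
  qed
qed

lemma odd_set_if_no_sink_card_le_3:
  assumes "finite V" and "card V \<le> 3" and "R \<subseteq> V \<times> V" and "asym R" and "V \<subseteq> Domain R"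
  shows "odd_set R V"
proof -
  have "Range R \<subseteq> V" "Range (R\<inverse>) \<subseteq> V" using \<open>R \<subseteq> V \<times> V\<close> by auto
  then show ?thesis
    using single_valued_if_no_sink_card_le_3[OF assms]
    by (simp add: odd_set_def odd_dominating_single_valued)
qed

lemma (in tournament) total_on_parcs: "total_on (pverts T) (parcs T)"
  unfolding total_on_def using one_direction by blast

lemma (in tournament) asym_parcs: "asym (parcs T)"
proof (rule asymI)
  fix u v assume "(u, v) \<in> parcs T"
  moreover from this have "u \<in> pverts T" "v \<in> pverts T" "u \<noteq> v"
    using in_arcsD1 in_arcsD2 no_loops' by blast+
  ultimately show "(v, u) \<notin> parcs T" using one_direction by blast
qed

lemma (in tournament) odd_set_exists_if_card_le_3:
  assumes "card (pverts T) \<le> 3"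
  obtains U where "U \<subseteq> pverts T" and "odd_set (parcs T) U"
proof -
  let ?V = "pverts T" and ?R = "parcs T"
  consider (no_sink) "?V \<subseteq> Domain ?R" | (no_source) "?V \<subseteq> Domain (?R\<inverse>)"
    | (source_sink) a z where "a \<in> ?V" "a \<notin> Range ?R" "z \<in> ?V" "z \<notin> Domain ?R"
    unfolding Domain_converse by blast
  then show thesis
  proof cases
    case no_sink
    with pair_finite_verts assms parcs_subset_pverts asym_parcs have "odd_set ?R ?V"
      by (rule odd_set_if_no_sink_card_le_3)
    then show thesis using that by blast
  next
    case no_source
    have "?R\<inverse> \<subseteq> ?V \<times> ?V" and "asym (?R\<inverse>)"
      using parcs_subset_pverts asym_parcs by (auto simp: asym_on_def)
    with pair_finite_verts assms have "odd_set (?R\<inverse>) ?V"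
      using no_source by (rule odd_set_if_no_sink_card_le_3)
    then have "odd_set ?R ?V" by (simp only: odd_set_converse)
    then show thesis using that by blast
  next
    case source_sink
    with total_on_parcs parcs_subset_pverts have "odd_set ?R {a, z}"
      by (rule odd_set_source_sink)
    then show thesis using that[of "{a, z}"] source_sink by simp
  qed
qed

theorem theorem4p3:
  fixes T :: "'a pair_pre_digraph"
    and s :: "'a \<Rightarrow> nat"
    and ET :: "'b pair_pre_digraph"
  assumes "tournament T"
    and "card (pverts T) \<le> 3"
    and "extended_tournament T s ET"
  shows "weak_odd_chromatic_index (with_proj ET) \<le> 2"
proof -
  obtain U where U: "U \<subseteq> pverts T" "odd_set (parcs T) U"
    by (rule tournament.odd_set_exists_if_card_le_3[OF assms(1,2)])
  obtain f where image_f: "f ` pverts ET = pverts T"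
    and parcs_ET: "parcs ET = Restr (inv_image (parcs T) f) (pverts ET)"
    by (rule extended_tournament_projection[OF assms(3)])
  have "U \<subseteq> f ` pverts ET" using U(1) image_f by simp
  then obtain S where "odd_set (parcs ET) S"
    by (rule odd_set_inv_image[OF U(2), of f "pverts ET", folded parcs_ET])
  then show ?thesis by (rule weak_odd_chromatic_index_le_2_if_odd_set)
qed

end
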